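(* Let $\alpha>-1$ and let $x,y,t$ be complex numbers. (1) If $ty\ne q^{-j}$ for all integers $j\ge 0$, then $$\sum_{n=0}^{\infty}\frac{(-1)^n q^{\binom n2}}{(q;q)_n}L_n^{(\alpha)}(x,y)\,t^n=(ty;q)_\infty\;{}_0\phi_2\left(\begin{gathered}-\\ q^{\alpha+1},\,ty\end{gathered};\,q,\,-q^{\alpha+1}tx\right).$$ (2) For arbitrarily given $\gamma\in\mathbb{C}$, and for $|ty|<1$ (with $\gamma ty\neq q^{-j}$ for all integers $j\ge 0$), $$\sum_{n=0}^{\infty}\frac{(\gamma;q)_n}{(q;q)_n}L_n^{(\alpha)}(x,y)\,t^n=\frac{(\gamma ty;q)_\infty}{(ty;q)_\infty}\;{}_1\phi_2\left(\begin{gathered}\gamma\\ q^{\alpha+1},\,\gamma ty\end{gathered};\,q,\,-q^{\alpha+1}tx\right).$$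
   Context: Fix $q$ with $0<|q|<1$; real powers $q^{s}$ are taken with respect to a fixed choice of $\log q$. $(a;q)_0=1$, $(a;q)_n=\prod_{i=0}^{n-1}(1-aq^i)$, $(a;q)_\infty=\prod_{i=0}^\infty(1-aq^i)$, and $\begin{bmatrix} n\\ k\end{bmatrix}=\frac{(q;q)_n}{(q;q)_k(q;q)_{n-k}}$. The basic hypergeometric series is $${}_r\phi_s\left(\begin{gathered}a_1,\dots,a_r\\ b_1,\dots,b_s\end{gathered};q,z\right)=\sum_{n=0}^\infty\frac{(a_1;q)_n\cdots(a_r;q)_n}{(b_1;q)_n\cdots(b_s;q)_n(q;q)_n}\Bigl[(-1)^nq^{\binom n2}\Bigr]^{1+s-r}z^n,$$ where a dash stands for an empty list of parameters. The homogeneous $q$-Laguerre polynomials are $$L_n^{(\alpha)}(x,y)=\sum_{k=0}^n\begin{bmatrix} n\\ k\end{bmatrix}\frac{q^{k^2+k\alpha}}{(q^{\alpha+1};q)_k}(-x)^k y^{n-k}.$$ *)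

theory Defs
  imports "HOL-Analysis.Analysis"
begin

definition qpoch :: "complex \<Rightarrow> complex \<Rightarrow> nat \<Rightarrow> complex" where
  "qpoch a q n = (\<Prod>i<n. 1 - a * q ^ i)"

definition qpoch_inf :: "complex \<Rightarrow> complex \<Rightarrow> complex" where
  "qpoch_inf a q = (\<Prod>i. 1 - a * q ^ i)"

text \<open>Only meaningful for \<open>k \<le> n\<close>, since \<open>n - k\<close> is truncated subtraction.\<close>

definition qbinom :: "complex \<Rightarrow> nat \<Rightarrow> nat \<Rightarrow> complex" where
  "qbinom q n k = qpoch q q n / (qpoch q q k * qpoch q q (n - k))"

text \<open>
  The real power \<open>q\<^sup>s\<close> with respect to a chosen logarithm \<open>lq\<close> of \<open>q\<close>, i.e. a number
  with \<open>exp lq = q\<close>, which need not be the principal value. For integer \<open>s\<close> it does not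
  depend on the choice and agrees with the ordinary power.
\<close>

definition qpow :: "complex \<Rightarrow> real \<Rightarrow> complex" where
  "qpow lq s = exp (of_real s * lq)"

text \<open>
  The basic hypergeometric series \<open>\<^sub>r\<phi>\<^sub>s\<close> with upper parameters \<open>as\<close> and lower parameters
  \<open>bs\<close>. The exponent \<open>1 + s - r\<close> is an integer and may be negative.
\<close>

definition qhyp :: "complex list \<Rightarrow> complex list \<Rightarrow> complex \<Rightarrow> complex \<Rightarrow> complex" where
  "qhyp as bs q z =
     (\<Sum>n. (\<Prod>a\<leftarrow>as. qpoch a q n) / ((\<Prod>b\<leftarrow>bs. qpoch b q n) * qpoch q q n) *
          ((-1) ^ n * q ^ (n choose 2)) powi (1 + int (length bs) - int (length as)) * z ^ n)"

text \<open>The homogeneous \<open>q\<close>-Laguerre polynomials; \<open>lq\<close> is the chosen logarithm of \<open>q\<close>.\<close>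

definition qLaguerre ::
    "complex \<Rightarrow> complex \<Rightarrow> real \<Rightarrow> nat \<Rightarrow> complex \<Rightarrow> complex \<Rightarrow> complex" where
  "qLaguerre q lq \<alpha> n x y =
     (\<Sum>k=0..n. qbinom q n k * (qpow lq (real k ^ 2 + real k * \<alpha>) / qpoch (qpow lq (\<alpha> + 1)) q k) *
              (- x) ^ k * y ^ (n - k))"

end

theory Submission
  imports Defs
begin

text \<open>
  Both identities are instances of one: replace the coefficient by
  \<open>\<Prod>i<n. b - a * q ^ i\<close>, which is \<open>(-1)\<^sup>n q\<^bsup>n choose 2\<^esup>\<close> for \<open>(a, b) = (1, 0)\<close> and
  \<open>(\<gamma>;q)\<^sub>n\<close> for \<open>(a, b) = (\<gamma>, 1)\<close>. Expanding the polynomials and exchanging the order of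
  summation, the inner sum becomes \<open>(a q\<^sup>k t y;q)\<^sub>\<infinity> / (b t y;q)\<^sub>\<infinity>\<close> by the \<open>q\<close>-binomial theorem.
  The latter follows by iterating the functional equation
  \<open>(1 - b z) F(z) = (1 - a z) F(q z)\<close>.
\<close>

section \<open>Homogeneous q-shifted factorials and infinite products\<close>

definition qpoch_hom :: "complex \<Rightarrow> complex \<Rightarrow> complex \<Rightarrow> nat \<Rightarrow> complex" where
  "qpoch_hom b a q n = (\<Prod>i<n. b - a * q ^ i)"

lemma qpoch_hom_0 [simp]: "qpoch_hom b a q 0 = 1"
  by (simp add: qpoch_hom_def)

lemma qpoch_hom_Suc: "qpoch_hom b a q (Suc n) = qpoch_hom b a q n * (b - a * q ^ n)"
  by (simp add: qpoch_hom_def)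

text \<open>Splitting off the first \<open>k\<close> factors moves \<open>a\<close> to
  \<open>a * q ^ k\<close> and leaves \<open>b\<close> alone, so each inner sum of the double series
  is again a q-binomial series, with the same denominator.\<close>

lemma qpoch_hom_add:
  "qpoch_hom b a q (k + m) = qpoch_hom b a q k * qpoch_hom b (a * q ^ k) q m"
  by (induction m) (simp_all add: qpoch_hom_Suc power_add mult.assoc)

lemma qpoch_hom_one: "qpoch_hom 1 a q n = qpoch a q n"
  by (simp add: qpoch_hom_def qpoch_def)

lemma qpoch_hom_zero: "qpoch_hom 0 1 q n = (-1) ^ n * q ^ (n choose 2)"
proof (induction n)
  case (Suc n)
  have "Suc n choose 2 = (n choose 2) + n"
    by (simp add: numeral_2_eq_2)
  then show ?case
    by (simp add: qpoch_hom_Suc Suc.IH power_add)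
qed (simp add: binomial_eq_0)

lemma qpoch_0 [simp]: "qpoch a q 0 = 1"
  by (simp add: qpoch_def)

lemma qpoch_Suc: "qpoch a q (Suc n) = qpoch a q n * (1 - a * q ^ n)"
  by (simp add: qpoch_def)

lemma qpoch_add: "qpoch a q (k + m) = qpoch a q k * qpoch (a * q ^ k) q m"
  using qpoch_hom_add[of 1 a q k m] by (simp add: qpoch_hom_one)

lemma one_minus_mult_power_nonzero:
  fixes a q :: complex
  assumes "norm q < 1" "norm a < 1"
  shows "1 - a * q ^ n \<noteq> 0"
proof
  assume "1 - a * q ^ n = 0"
  then have "norm a * norm q ^ n = 1"
    by (metis eq_iff_diff_eq_0 norm_mult norm_one norm_power)
  moreover have "norm a * norm q ^ n \<le> norm a * 1"
    using assms by (intro mult_left_mono power_le_one) auto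
  ultimately show False using assms by simp
qed

lemma qpoch_nonzero:
  assumes "norm q < 1" "norm a < 1"
  shows "qpoch a q n \<noteq> 0"
  unfolding qpoch_def using one_minus_mult_power_nonzero[OF assms] by simp

lemma convergent_prod_qpoch:
  fixes a q :: complex
  assumes "norm q < 1"
  shows "convergent_prod (\<lambda>i. 1 - a * q ^ i)"
proof -
  have "summable (\<lambda>i. norm a * norm q ^ i)"
    using assms by (intro summable_mult summable_geometric) simp
  then have "abs_convergent_prod (\<lambda>i. 1 - a * q ^ i)"
    by (intro summable_imp_abs_convergent_prod) (simp add: norm_mult norm_power)
  then show ?thesis
    by (rule abs_convergent_prod_imp_convergent_prod)
qed

lemma qpoch_tendsto_qpoch_inf:
  assumes "norm q < 1"
  shows "qpoch a q \<longlonglongrightarrow> qpoch_inf a q"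
  using convergent_prod_LIMSEQ[OF convergent_prod_qpoch[OF assms, of a]]
  unfolding qpoch_def qpoch_inf_def by (simp add: LIMSEQ_lessThan_iff_atMost)

lemma qpoch_inf_nonzero:
  assumes "norm q < 1" "norm a < 1"
  shows "qpoch_inf a q \<noteq> 0"
  unfolding qpoch_inf_def
  by (intro prodinf_nonzero convergent_prod_qpoch one_minus_mult_power_nonzero assms)

text \<open>The limit of \<open>qpoch_add\<close>. It later trades the infinite product shifted by
  \<open>q ^ k\<close> for the lower parameter of the hypergeometric series.\<close>

lemma qpoch_inf_split:
  assumes "norm q < 1"
  shows "qpoch_inf a q = qpoch a q k * qpoch_inf (a * q ^ k) q"
proof (rule LIMSEQ_unique)
  show "(\<lambda>m. qpoch a q (m + k)) \<longlonglongrightarrow> qpoch_inf a q"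
    using qpoch_tendsto_qpoch_inf[OF assms] by (rule LIMSEQ_ignore_initial_segment)
  show "(\<lambda>m. qpoch a q (m + k)) \<longlonglongrightarrow> qpoch a q k * qpoch_inf (a * q ^ k) q"
    unfolding add.commute[of _ k] qpoch_add
    by (intro tendsto_intros qpoch_tendsto_qpoch_inf assms)
qed

section \<open>Majorants and the q-binomial theorem\<close>

text \<open>The ratio enters as a factor, not as a quotient, because terms may vanish, for instance
  when \<open>x = 0\<close> or some \<open>b - a * q ^ n\<close> is 0.\<close>

lemma summable_norm_ratio_limit:
  fixes f r :: "nat \<Rightarrow> 'a :: real_normed_div_algebra"
  assumes step: "\<And>n. f (Suc n) = r n * f n" and lim: "r \<longlonglongrightarrow> L" and L: "norm L < 1"
  shows "summable (\<lambda>n. norm (f n))"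
proof -
  obtain c where c: "norm L < c" "c < 1"
    using dense[OF L] by blast
  from order_tendstoD(2)[OF tendsto_norm[OF lim] c(1)]
  obtain N where N: "\<And>n. n \<ge> N \<Longrightarrow> norm (r n) < c"
    unfolding eventually_sequentially by blast
  show ?thesis
  proof (rule summable_ratio_test[OF c(2)])
    fix n assume "n \<ge> N"
    then show "norm (norm (f (Suc n))) \<le> c * norm (norm (f n))"
      using N[of n] by (simp add: step norm_mult mult_right_mono)
  qed
qed

text \<open>Since \<open>q ^ k\<close> has norm at most 1, the bound can be taken independent of
  \<open>k\<close>. This uniformity gives the double series a majorant of product form.\<close>

lemma norm_qpoch_hom_le:
  assumes "norm q < 1"
  shows "norm (qpoch_hom b (a * q ^ k) q m) \<le> (\<Prod>i<m. norm b + norm a * norm q ^ i)"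
proof -
  have "norm (b - a * q ^ k * q ^ i) \<le> norm b + norm a * norm q ^ i" for i
  proof -
    have "norm (b - a * q ^ k * q ^ i) \<le> norm b + norm q ^ k * (norm a * norm q ^ i)"
      by (rule order_trans[OF norm_triangle_ineq4]) (simp add: norm_mult norm_power mult_ac)
    also have "\<dots> \<le> norm b + 1 * (norm a * norm q ^ i)"
      using assms by (intro add_left_mono mult_right_mono power_le_one) auto
    finally show ?thesis by simp
  qed
  then show ?thesis
    unfolding qpoch_hom_def prod_norm[symmetric] by (intro prod_mono) auto
qed

text \<open>The powers of \<open>q\<close> die out in the ratio of consecutive terms, which
  therefore tends to \<open>norm (b * z)\<close>.\<close>

lemma summable_q_binomial_majorant:
  fixes q z :: complex
  assumes "norm q < 1" and "norm (b * z) < 1"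
  shows "summable (\<lambda>n. (\<Prod>i<n. norm b + norm a * norm q ^ i) * norm (z ^ n / qpoch q q n))"
    (is "summable ?f")
proof -
  let ?r = "\<lambda>n. (norm b + norm a * norm q ^ n) * norm z / norm (1 - q * q ^ n)"
  have "(\<lambda>n. norm q ^ n) \<longlonglongrightarrow> 0" "(\<lambda>n. q ^ n) \<longlonglongrightarrow> 0"
    using assms(1) by (auto intro!: LIMSEQ_power_zero)
  then have "?r \<longlonglongrightarrow> (norm b + norm a * 0) * norm z / norm (1 - q * 0)"
    by (intro tendsto_intros) (use assms in auto)
  then have "?r \<longlonglongrightarrow> norm b * norm z" by simp
  moreover have "?f (Suc n) = ?r n * ?f n" for n
    by (simp add: qpoch_Suc norm_mult norm_divide norm_power mult_ac)
  moreover have "norm (norm b * norm z) < 1"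
    using assms(2) by (simp add: norm_mult)
  ultimately have "summable (\<lambda>n. norm (?f n))"
    by (intro summable_norm_ratio_limit)
  then show ?thesis by (rule summable_norm_cancel)
qed

text \<open>Cauchy's q-binomial theorem in homogeneous form. For \<open>b = 0\<close> it is Euler's
  expansion of \<open>qpoch_inf (a * z) q\<close>, valid for every \<open>z\<close>.\<close>

lemma q_binomial_sums:
  assumes q: "norm q < 1" and bz: "norm (b * z) < 1"
  shows "(\<lambda>n. qpoch_hom b a q n * (z ^ n / qpoch q q n)) sums
           (qpoch_inf (a * z) q / qpoch_inf (b * z) q)"
proof -
  define c where "c n = qpoch_hom b a q n / qpoch q q n" for n
  define F where "F w = (\<Sum>n. c n * w ^ n)" for w
  have smb: "summable (\<lambda>n. c n * w ^ n)" if "norm (b * w) < 1" for w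
  proof (rule summable_comparison_test'[OF summable_q_binomial_majorant[OF q that, of a]])
    show "norm (c n * w ^ n) \<le> (\<Prod>i<n. norm b + norm a * norm q ^ i) * norm (w ^ n / qpoch q q n)"
      for n
      using mult_right_mono[OF norm_qpoch_hom_le[OF q, of b a 0 n], of "norm (w ^ n / qpoch q q n)"]
      by (simp add: c_def norm_mult norm_divide)
  qed
  \<comment> \<open>The functional equation of \<open>F\<close>, read off coefficientwise.\<close>
  have c_Suc: "c (Suc n) * (1 - q ^ Suc n) = c n * (b - a * q ^ n)" for n
    using one_minus_mult_power_nonzero[OF q q, of n]
    by (simp add: c_def qpoch_hom_Suc qpoch_Suc divide_simps)
  have small: "norm (b * (q ^ n * z)) < 1" for n
  proof -
    have "norm (b * (q ^ n * z)) = norm q ^ n * norm (b * z)"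
      by (simp add: norm_mult norm_power)
    also have "\<dots> \<le> 1 * norm (b * z)"
      using q by (intro mult_right_mono power_le_one) auto
    finally show ?thesis using bz by simp
  qed
  have step: "(1 - b * w) * F w = (1 - a * w) * F (q * w)"
    if w: "norm (b * w) < 1" "norm (b * (q * w)) < 1" for w
  proof -
    have s: "(\<lambda>n. c n * w ^ n) sums F w" "(\<lambda>n. c n * (q * w) ^ n) sums F (q * w)"
      unfolding F_def by (intro summable_sums smb w)+
    then have "(\<lambda>n. c n * w ^ n - c n * (q * w) ^ n) sums (F w - F (q * w))"
      by (rule sums_diff)
    \<comment> \<open>The constant terms of the two series cancel, so shifting the index leaves the
      sum unchanged.\<close>
    then have "(\<lambda>n. c (Suc n) * w ^ Suc n - c (Suc n) * (q * w) ^ Suc n) sums (F w - F (q * w))"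
      by (subst sums_Suc_iff) simp
    moreover have "c (Suc n) * w ^ Suc n - c (Suc n) * (q * w) ^ Suc n =
        b * w * (c n * w ^ n) - a * w * (c n * (q * w) ^ n)" for n
    proof -
      have "c (Suc n) * w ^ Suc n - c (Suc n) * (q * w) ^ Suc n =
          c (Suc n) * (1 - q ^ Suc n) * w ^ Suc n"
        by (simp add: power_mult_distrib algebra_simps)
      also have "\<dots> = b * w * (c n * w ^ n) - a * w * (c n * (q * w) ^ n)"
        unfolding c_Suc by (simp add: power_mult_distrib algebra_simps)
      finally show ?thesis .
    qed
    ultimately have "(\<lambda>n. b * w * (c n * w ^ n) - a * w * (c n * (q * w) ^ n)) sums
        (F w - F (q * w))"
      by simp
    moreover have "(\<lambda>n. b * w * (c n * w ^ n) - a * w * (c n * (q * w) ^ n)) sums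
        (b * w * F w - a * w * F (q * w))"
      by (intro sums_diff sums_mult s)
    ultimately have "F w - F (q * w) = b * w * F w - a * w * F (q * w)"
      by (rule sums_unique2)
    then show ?thesis by (simp add: algebra_simps)
  qed
  \<comment> \<open>As \<open>n\<close> grows, both finite products converge and the argument on the
    right tends to 0, where \<open>F\<close> is 1; this determines \<open>F z\<close>.\<close>
  have iter: "qpoch (b * z) q n * F z = qpoch (a * z) q n * F (q ^ n * z)" for n
  proof (induction n)
    case (Suc n)
    have "qpoch (b * z) q (Suc n) * F z =
        (1 - b * (q ^ n * z)) * (qpoch (b * z) q n * F z)"
      by (simp add: qpoch_Suc algebra_simps)
    also have "\<dots> = qpoch (a * z) q n * ((1 - b * (q ^ n * z)) * F (q ^ n * z))"
      unfolding Suc.IH by (simp add: algebra_simps)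
    also have "\<dots> = qpoch (a * z) q n * ((1 - a * (q ^ n * z)) * F (q ^ Suc n * z))"
      using step[of "q ^ n * z"] small[of n] small[of "Suc n"] by (simp add: mult.assoc)
    finally show ?case by (simp add: qpoch_Suc algebra_simps)
  qed simp
  have "(\<lambda>n. F (q ^ n * z)) \<longlonglongrightarrow> 1"
  \<comment> \<open>Continuity at 0 comes from convergence at a point of positive norm, here
    \<open>z\<close> itself; hence the separate case \<open>z = 0\<close>.\<close>
  proof (cases "z = 0")
    case True
    have "F 0 = 1" unfolding F_def powser_zero by (simp add: c_def)
    with True show ?thesis by simp
  next
    case False
    have "isCont F 0"
      unfolding F_def
      by (rule isCont_powser[where K = z]) (use smb[OF bz] False in auto)
    moreover have "(\<lambda>n. q ^ n * z) \<longlonglongrightarrow> 0 * z"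
      by (intro tendsto_intros LIMSEQ_power_zero q)
    ultimately have "(\<lambda>n. F (q ^ n * z)) \<longlonglongrightarrow> F 0"
      by (metis isCont_tendsto_compose mult_zero_left)
    also have "F 0 = 1" unfolding F_def powser_zero by (simp add: c_def)
    finally show ?thesis .
  qed
  then have "(\<lambda>n. qpoch (a * z) q n * F (q ^ n * z)) \<longlonglongrightarrow> qpoch_inf (a * z) q * 1"
    by (intro tendsto_intros qpoch_tendsto_qpoch_inf q)
  moreover have "(\<lambda>n. qpoch (b * z) q n * F z) \<longlonglongrightarrow> qpoch_inf (b * z) q * F z"
    by (intro tendsto_intros qpoch_tendsto_qpoch_inf q)
  ultimately have "qpoch_inf (b * z) q * F z = qpoch_inf (a * z) q"
    unfolding iter using LIMSEQ_unique by fastforce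
  then have "F z = qpoch_inf (a * z) q / qpoch_inf (b * z) q"
    using qpoch_inf_nonzero[OF q bz] by (simp add: field_simps)
  then show ?thesis
    using summable_sums[OF smb[OF bz]] by (simp add: F_def c_def)
qed

section \<open>Rearrangement of double series\<close>

text \<open>The product majorant makes the family absolutely summable over all pairs, so summing by
  rows and by antidiagonals gives the same value \<open>S\<close>.\<close>

lemma sums_diagonal:
  fixes f :: "nat \<Rightarrow> nat \<Rightarrow> 'a :: banach"
  assumes bound: "\<And>k m. norm (f k m) \<le> U k * V m"
    and U: "summable U" "\<And>k. 0 \<le> U k" and V: "summable V" "\<And>m. 0 \<le> V m"
    and g: "\<And>k. f k sums g k"
  shows "\<exists>S. g sums S \<and> (\<lambda>n. \<Sum>k\<le>n. f k (n - k)) sums S"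
proof -
  have "(\<lambda>(k, m). U k * V m) summable_on (UNIV \<times> UNIV)"
  proof (rule summable_on_SigmaI)
    show "((\<lambda>m. case (k, m) of (k, m) \<Rightarrow> U k * V m) has_sum U k * suminf V) UNIV" for k
      using V by (auto intro!: has_sum_cmult_right sums_nonneg_imp_has_sum summable_sums)
    show "(\<lambda>k. U k * suminf V) summable_on UNIV"
      using U V by (intro summable_on_cmult_left) (simp add: summable_on_UNIV_nonneg_real_iff)
  qed (use U V in auto)
  then have "(\<lambda>p. norm (case p of (k, m) \<Rightarrow> f k m)) summable_on (UNIV \<times> UNIV)"
    by (rule Infinite_Sum.abs_summable_on_comparison_test') (use bound in auto)
  then have "(\<lambda>(k, m). f k m) summable_on (UNIV \<times> UNIV)"
    by (rule abs_summable_summable)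
  then obtain S where S: "((\<lambda>(k, m). f k m) has_sum S) (UNIV \<times> UNIV)"
    unfolding summable_on_def by blast
  have row: "(f k has_sum g k) UNIV" for k
  proof (rule norm_summable_imp_has_sum[OF _ g])
    show "summable (\<lambda>m. norm (f k m))"
      by (rule summable_comparison_test'[OF summable_mult[OF V(1), of "U k"]])
        (use bound in auto)
  qed
  have "(g has_sum S) UNIV"
    by (rule has_sum_SigmaD[OF S]) (use row in auto)
  \<comment> \<open>Pairs \<open>(k, m)\<close> correspond to points \<open>(k + m, k)\<close> of
    the triangle \<open>k \<le> n\<close>.\<close>
  moreover have "((\<lambda>(n, k). f k (n - k)) has_sum S) (SIGMA n:UNIV. {..n})"
    using S
    by (rule has_sum_reindex_bij_witness
        [where i = "\<lambda>(n, k). (k, n - k)" and j = "\<lambda>(k, m). (k + m, k)", THEN iffD1, rotated -1])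
      auto
  then have "((\<lambda>n. \<Sum>k\<le>n. f k (n - k)) has_sum S) UNIV"
    by (rule has_sum_SigmaD) (simp add: has_sum_finite)
  ultimately show ?thesis
    by (blast intro: has_sum_imp_sums)
qed

section \<open>The generating function with general coefficients\<close>

text \<open>The exponent equals \<open>2 * (k choose 2) + k * (\<alpha> + 1)\<close>. Its first part
  is an integer, so the choice of logarithm matters only for
  \<open>qpow lq (\<alpha> + 1)\<close>.\<close>

lemma qpow_square:
  assumes "exp lq = q"
  shows "qpow lq (real k ^ 2 + real k * \<alpha>) = (q ^ (k choose 2)) ^ 2 * qpow lq (\<alpha> + 1) ^ k"
proof -
  have "2 * (k choose 2) + k = k ^ 2"
    by (induction k) (simp_all add: numeral_2_eq_2)
  then have "real k ^ 2 = 2 * real (k choose 2) + real k"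
    by (metis of_nat_add of_nat_mult of_nat_numeral of_nat_power)
  then have "of_real (real k ^ 2 + real k * \<alpha>) * lq =
      of_nat (2 * (k choose 2)) * lq + of_nat k * (of_real (\<alpha> + 1) * lq)"
    by (simp add: algebra_simps)
  then have "qpow lq (real k ^ 2 + real k * \<alpha>) = q ^ (2 * (k choose 2)) * qpow lq (\<alpha> + 1) ^ k"
    unfolding qpow_def by (simp only: exp_add exp_of_nat_mult assms)
  then show ?thesis
    by (simp only: power_even_eq)
qed

lemma qLaguerre_gen_fun_sums:
  fixes \<alpha> :: real
  assumes q: "norm q < 1" and lq: "exp lq = q"
    and bty: "norm (b * (t * y)) < 1" and aty: "\<And>k. qpoch (a * (t * y)) q k \<noteq> 0"
  defines "A \<equiv> qpow lq (\<alpha> + 1)"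
  shows "(\<lambda>n. qpoch_hom b a q n / qpoch q q n * qLaguerre q lq \<alpha> n x y * t ^ n) sums
    (qpoch_inf (a * (t * y)) q / qpoch_inf (b * (t * y)) q *
      (\<Sum>k. qpoch_hom b a q k / (qpoch A q k * qpoch (a * (t * y)) q k * qpoch q q k) *
        (q ^ (k choose 2)) ^ 2 * (- A * t * x) ^ k))"
proof -
  \<comment> \<open>With \<open>n = k + m\<close>, the factor \<open>qpoch q q n\<close> of the
    q-binomial coefficient cancels against the denominator of the series. What remains separates
    into \<open>u k\<close> and \<open>v m\<close>, coupled only by
    \<open>qpoch_hom b a q (k + m)\<close>.\<close>
  define u where "u k = (q ^ (k choose 2)) ^ 2 * (- A * t * x) ^ k / (qpoch q q k * qpoch A q k)" for k
  define v where "v m = (t * y) ^ m / qpoch q q m" for m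
  define f where "f k m = qpoch_hom b a q (k + m) * u k * v m" for k m
  define C where "C = qpoch_inf (a * (t * y)) q / qpoch_inf (b * (t * y)) q"
  define h where "h k = qpoch_hom b a q k * u k / qpoch (a * (t * y)) q k" for k
  have nz: "qpoch q q k \<noteq> 0" for k
    by (rule qpoch_nonzero[OF q q])
  have "summable (\<lambda>k. norm (qpoch_hom b a q k * u k))"
  proof (rule summable_norm_ratio_limit)
    let ?r = "\<lambda>k. (b - a * q ^ k) * (q ^ k) ^ 2 * (- A * t * x) / ((1 - q * q ^ k) * (1 - A * q ^ k))"
    have "(\<lambda>n. q ^ n) \<longlonglongrightarrow> 0"
      using q by (rule LIMSEQ_power_zero)
    \<comment> \<open>The factor \<open>(q ^ k) ^ 2\<close> forces the limit 0, whence convergence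
      for every \<open>x\<close>.\<close>
    then have "?r \<longlonglongrightarrow> (b - a * 0) * 0 ^ 2 * (- A * t * x) / ((1 - q * 0) * (1 - A * 0))"
      by (intro tendsto_intros) (use assms in auto)
    then show "?r \<longlonglongrightarrow> 0" by simp
    have ch: "Suc n choose 2 = (n choose 2) + n" for n
      by (simp add: numeral_2_eq_2)
    show "qpoch_hom b a q (Suc k) * u (Suc k) = ?r k * (qpoch_hom b a q k * u k)" for k
      unfolding u_def qpoch_hom_Suc qpoch_Suc ch power_add power_mult_distrib power_Suc
      by (simp add: mult_ac)
  qed simp
  moreover have "summable (\<lambda>m. (\<Prod>i<m. norm b + norm a * norm q ^ i) * norm (v m))"
    unfolding v_def by (rule summable_q_binomial_majorant[OF q bty])
  moreover have "norm (f k m) \<le> norm (qpoch_hom b a q k * u k) *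
      ((\<Prod>i<m. norm b + norm a * norm q ^ i) * norm (v m))" for k m
  proof -
    have "norm (f k m) = norm (qpoch_hom b a q k * u k) *
        (norm (qpoch_hom b (a * q ^ k) q m) * norm (v m))"
      by (simp add: f_def qpoch_hom_add norm_mult)
    also have "\<dots> \<le> norm (qpoch_hom b a q k * u k) *
      ((\<Prod>i<m. norm b + norm a * norm q ^ i) * norm (v m))"
      by (intro mult_left_mono mult_right_mono norm_qpoch_hom_le q) auto
    finally show ?thesis .
  qed
  moreover have "f k sums (C * h k)" for k
  proof -
    have "(\<lambda>m. qpoch_hom b (a * q ^ k) q m * v m) sums
        (qpoch_inf (a * q ^ k * (t * y)) q / qpoch_inf (b * (t * y)) q)"
      unfolding v_def by (rule q_binomial_sums[OF q bty])
    then have "(\<lambda>m. qpoch_hom b a q k * u k * (qpoch_hom b (a * q ^ k) q m * v m)) sums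
        (qpoch_hom b a q k * u k *
          (qpoch_inf (a * q ^ k * (t * y)) q / qpoch_inf (b * (t * y)) q))"
      by (rule sums_mult)
    \<comment> \<open>Dividing by \<open>qpoch (a * (t * y)) q k\<close>, nonzero by
      \<open>aty\<close>, frees the infinite product from \<open>k\<close> and leaves the constant
      \<open>C\<close>.\<close>
    moreover have "qpoch_inf (a * (t * y)) q =
        qpoch (a * (t * y)) q k * qpoch_inf (a * q ^ k * (t * y)) q"
      using qpoch_inf_split[OF q, of "a * (t * y)" k] by (simp add: mult_ac)
    ultimately show ?thesis
      using aty[of k] by (simp add: f_def[abs_def] C_def h_def qpoch_hom_add mult_ac)
  qed
  ultimately obtain S where
    S: "(\<lambda>k. C * h k) sums S" "(\<lambda>n. \<Sum>k\<le>n. f k (n - k)) sums S"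
    using sums_diagonal[of f "\<lambda>k. norm (qpoch_hom b a q k * u k)"
        "\<lambda>m. (\<Prod>i<m. norm b + norm a * norm q ^ i) * norm (v m)" "\<lambda>k. C * h k"]
    by (force intro!: mult_nonneg_nonneg prod_nonneg)
  have "(\<Sum>k\<le>n. f k (n - k)) =
      qpoch_hom b a q n / qpoch q q n * qLaguerre q lq \<alpha> n x y * t ^ n" for n
    unfolding qLaguerre_def sum_distrib_left sum_distrib_right atLeast0AtMost
  proof (rule sum.cong)
    fix k assume "k \<in> {..n}"
    then have k: "k \<le> n" by simp
    then have "t ^ n = t ^ k * t ^ (n - k)"
      by (simp flip: power_add)
    moreover have sgn: "(- A * t * x) ^ k = A ^ k * t ^ k * (- x) ^ k"
      by (simp flip: power_mult_distrib)
    ultimately show "f k (n - k) = qpoch_hom b a q n / qpoch q q n *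
        (qbinom q n k * (qpow lq (real k ^ 2 + real k * \<alpha>) / qpoch (qpow lq (\<alpha> + 1)) q k) *
          (- x) ^ k * y ^ (n - k)) * t ^ n"
      using k nz[of n]
      unfolding f_def u_def v_def qbinom_def qpow_square[OF lq] A_def[symmetric] sgn
      by (simp add: power_mult_distrib[of t y] mult_ac)
  qed simp
  moreover have "S = C * (\<Sum>k. h k)"
  \<comment> \<open>Summability of \<open>h\<close> follows from that of \<open>C * h k\<close> only
    for nonzero \<open>C\<close>; otherwise both sides are 0.\<close>
  proof (cases "C = 0")
    case False
    then have "summable h"
      using S(1) by (simp add: sums_iff)
    then show ?thesis
      using S(1) by (simp add: sums_iff suminf_mult)
  qed (use S(1) in \<open>simp add: sums_iff\<close>)
  ultimately show ?thesis
    using S(2) by (simp add: C_def h_def u_def mult_ac)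
qed

section \<open>The two specializations\<close>

lemma qpoch_nonzeroI:
  assumes "q \<noteq> 0" "\<And>j::nat. a \<noteq> q powi (- int j)"
  shows "qpoch a q n \<noteq> 0"
  using assms by (auto simp: qpoch_def power_int_minus field_simps)

theorem theorem3p2:
  fixes q lq x y t :: complex and \<alpha> :: real
  assumes "0 < norm q" and "norm q < 1" and "exp lq = q" and "\<alpha> > -1"
  shows
    "((\<forall>j::nat. t * y \<noteq> q powi (- int j)) \<longrightarrow>
        (\<lambda>n. (-1) ^ n * q ^ (n choose 2) / qpoch q q n * qLaguerre q lq \<alpha> n x y * t ^ n) sums
        (qpoch_inf (t * y) q *
           qhyp [] [qpow lq (\<alpha> + 1), t * y] q (- qpow lq (\<alpha> + 1) * t * x)))
     \<and>
     (\<forall>\<gamma>::complex. norm (t * y) < 1 \<longrightarrow> (\<forall>j::nat. \<gamma> * t * y \<noteq> q powi (- int j)) \<longrightarrow>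
        (\<lambda>n. qpoch \<gamma> q n / qpoch q q n * qLaguerre q lq \<alpha> n x y * t ^ n) sums
        (qpoch_inf (\<gamma> * t * y) q / qpoch_inf (t * y) q *
           qhyp [\<gamma>] [qpow lq (\<alpha> + 1), \<gamma> * t * y] q (- qpow lq (\<alpha> + 1) * t * x)))"
proof (intro conjI impI allI)
  assume *: "\<forall>j::nat. t * y \<noteq> q powi (- int j)"
  have "qpoch (1 * (t * y)) q k \<noteq> 0" for k
    using assms * by (intro qpoch_nonzeroI) auto
  \<comment> \<open>For \<open>b = 0\<close> the open premise \<open>norm (b * (t * y)) < 1\<close>
    is trivial, so \<open>t * y\<close> may be arbitrarily large.\<close>
  from qLaguerre_gen_fun_sums[OF assms(2,3) _ this, where b = 0 and x = x]
  have "(\<lambda>n. qpoch_hom 0 1 q n / qpoch q q n * qLaguerre q lq \<alpha> n x y * t ^ n) sums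
    (qpoch_inf (t * y) q / qpoch_inf 0 q *
      (\<Sum>k. qpoch_hom 0 1 q k / (qpoch (qpow lq (\<alpha> + 1)) q k * qpoch (t * y) q k * qpoch q q k) *
        (q ^ (k choose 2)) ^ 2 * (- qpow lq (\<alpha> + 1) * t * x) ^ k))"
    by simp
  moreover have "qpoch_inf 0 q = 1"
    by (simp add: qpoch_inf_def)
  \<comment> \<open>Of the three factors prescribed for r = 0 and s = 2, one is the coefficient
    \<open>qpoch_hom 0 1 q k\<close>; the other two form the square coming from the polynomials,
    where the sign disappears.\<close>
  moreover have "((-1) ^ k * q ^ (k choose 2)) powi 3 = (-1) ^ k * q ^ (k choose 2) * (q ^ (k choose 2)) ^ 2"
    for k
    by (simp add: power_mult_distrib power3_eq_cube power2_eq_square flip: power_mult)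
  ultimately show "(\<lambda>n. (-1) ^ n * q ^ (n choose 2) / qpoch q q n * qLaguerre q lq \<alpha> n x y * t ^ n) sums
        (qpoch_inf (t * y) q *
           qhyp [] [qpow lq (\<alpha> + 1), t * y] q (- qpow lq (\<alpha> + 1) * t * x))"
    by (simp add: qhyp_def qpoch_hom_zero mult_ac)
next
  fix \<gamma> :: complex
  assume ty: "norm (t * y) < 1" and *: "\<forall>j::nat. \<gamma> * t * y \<noteq> q powi (- int j)"
  have "qpoch (\<gamma> * (t * y)) q k \<noteq> 0" for k
    using assms * by (intro qpoch_nonzeroI) (auto simp: mult.assoc)
  \<comment> \<open>For r = 1 and s = 2 the exponent is 2, so the bracket is exactly the square from
    the polynomials.\<close>
  from qLaguerre_gen_fun_sums[OF assms(2,3) _ this, where b = 1 and x = x] ty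
  show "(\<lambda>n. qpoch \<gamma> q n / qpoch q q n * qLaguerre q lq \<alpha> n x y * t ^ n) sums
        (qpoch_inf (\<gamma> * t * y) q / qpoch_inf (t * y) q *
           qhyp [\<gamma>] [qpow lq (\<alpha> + 1), \<gamma> * t * y] q (- qpow lq (\<alpha> + 1) * t * x))"
    by (simp add: qhyp_def qpoch_hom_one mult.assoc power_mult_distrib flip: power_mult)
qed

end
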